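(* Let $a,b$ be coprime positive integers, and let $m>0$ and $n\ge 0$ be integers. Then $$ V_{m,n}(a,b)=\frac{1}{b^n}\sum_{\substack{0\le i_0,\dots,i_{b-1}\le n\\ i_0+\dots+i_{b-1}=n}}\binom{n}{i_0\dots i_{b-1}}\left(\prod_{j=0}^{b-1}C_{S_{a,b}}(\epsilon_b^j)^{i_j}\right) M_{b-1}\left(\epsilon_b^{-a\sum_{j=0}^{b-1}ji_j},m\right) $$ $$ =\frac{1}{b^n}\sum_{\substack{0\le i_0,\dots,i_{b-1}\le n\\ i_0+\dots+i_{b-1}=n}}\binom{n}{i_0\dots i_{b-1}}\left(\prod_{j=0}^{b-1}C_{S_{a,b}}(\epsilon_b^j)^{i_j}\right)\frac{B_{m+1}\left(b,\epsilon_b^{-a\sum_{j=0}^{b-1}ji_j}\right)-B_{m+1}\left(0,\epsilon_b^{-a\sum_{j=0}^{b-1}ji_j}\right)}{m+1}. $$ In particular, $$ V_{m,1}(a,b)=\frac{1}{b}\sum_{j=0}^{b-1}C_{S_{a,b}}(\epsilon_b^j)M_{b-1}(\epsilon_b^{-aj},m) =\frac{1}{b}\sum_{j=0}^{b-1}C_{S_{a,b}}(\epsilon_b^j)\frac{B_{m+1}(b,\epsilon_b^{-aj})-B_{m+1}(0,\epsilon_b^{-aj})}{m+1}. $$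
   Context: For coprime positive integers $a,b$, $S_{a,b}=\{xa+yb: x,y\in\mathbb Z_{\ge 0}\}$ is the numerical semigroup generated by $a$ and $b$, $C_{S_{a,b}}:=\mathbb Z_{\ge 0}\setminus S_{a,b}$ (a finite set), and $C_{S_{a,b}}(q):=\sum_{k\in C_{S_{a,b}}}q^k$. $\epsilon_b:=e^{2\pi i/b}$ with $i=\sqrt{-1}$, and $[x]$ is the integer part (floor) of $x$. The Voronoi sums are $V_{m,n}(a,b):=\sum_{k=1}^{b-1}k^m\left[\frac{ak}{b}\right]^n$. The Mirimanoff polynomials are $M_{b-1}(\lambda,m):=\sum_{k=0}^{b-1}k^m\lambda^k$. The Apostol-Bernoulli polynomials $B_k(q,\lambda)$ are defined by the generating function $\frac{te^{tq}}{\lambda e^t-1}=\sum_{k=0}^\infty B_k(q,\lambda)\frac{t^k}{k!}$. $\binom{n}{i_0\dots i_{b-1}}=\frac{n!}{i_0!\cdots i_{b-1}!}$ is the multinomial coefficient. The convention $0^0=1$ is used. *)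

theory Defs
  imports "HOL-Analysis.Analysis" "HOL-Computational_Algebra.Formal_Power_Series" "HOL-Number_Theory.Cong"
begin

definition numerical_semigroup :: "nat \<Rightarrow> nat \<Rightarrow> nat set" where
  "numerical_semigroup a b = {x * a + y * b | x y. True}"

definition semigroup_gaps :: "nat \<Rightarrow> nat \<Rightarrow> nat set" where
  "semigroup_gaps a b = UNIV - numerical_semigroup a b"

definition gap_poly :: "nat \<Rightarrow> nat \<Rightarrow> complex \<Rightarrow> complex" where
  "gap_poly a b q = (\<Sum>k\<in>semigroup_gaps a b. q ^ k)"

text \<open>The sum in \<^term>\<open>gap_poly a b q\<close> is a genuine finite sum in the coprime case.\<close>

lemma finite_semigroup_gaps:
  fixes a b :: nat
  assumes "a > 0" "b > 0" "coprime a b"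
  shows "finite (semigroup_gaps a b)"
proof (rule finite_subset)
  show "semigroup_gaps a b \<subseteq> {..<a * b}"
  proof
    fix k assume k: "k \<in> semigroup_gaps a b"
    show "k \<in> {..<a * b}"
    proof (rule ccontr)
      assume "k \<notin> {..<a * b}"
      hence ge: "a * b \<le> k" by simp
      obtain x where x: "[a * x = k] (mod b)"
        using cong_solve_coprime_nat[OF assms(3)]
        by (metis cong_scalar_left cong_scalar_right mult.assoc mult.left_neutral One_nat_def)
      define x' where "x' = x mod b"
      have x': "x' < b" "[a * x' = k] (mod b)"
        using assms x by (auto simp: x'_def cong_def mod_mult_right_eq)
      have le: "a * x' \<le> k"
        using x'(1) ge by (meson le_trans less_imp_le mult_le_mono2)
      hence "b dvd k - a * x'"
        using x'(2) by (metis cong_sym cong_altdef_nat)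
      then obtain y where "k - a * x' = b * y" by (elim dvdE)
      hence "k = x' * a + y * b" using le by (simp add: algebra_simps)
      thus False using k by (auto simp: semigroup_gaps_def numerical_semigroup_def)
    qed
  qed
qed simp

definition eps :: "nat \<Rightarrow> complex" where
  "eps b = exp (2 * of_real pi * \<i> / of_nat b)"

definition voronoi_sum :: "nat \<Rightarrow> nat \<Rightarrow> nat \<Rightarrow> nat \<Rightarrow> int" where
  "voronoi_sum m n a b =
     (\<Sum>k=1..b - 1. int k ^ m * \<lfloor>real a * real k / real b\<rfloor> ^ n)"

definition mirimanoff :: "nat \<Rightarrow> complex \<Rightarrow> nat \<Rightarrow> complex" where
  "mirimanoff N \<mu> m = (\<Sum>k=0..N. of_nat k ^ m * \<mu> ^ k)"

text \<open>The quotient below is the one of formal power series in \<open>t\<close>. For \<open>\<mu> = 1\<close> the denominator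
  has order one, so the quotient is still exact and yields the classical Bernoulli polynomials;
  see \<open>apostol_bernoulli_genfun\<close>.\<close>

definition apostol_bernoulli :: "nat \<Rightarrow> complex \<Rightarrow> complex \<Rightarrow> complex" where
  "apostol_bernoulli k q \<mu> =
     fact k * fps_nth (fps_X * fps_exp q / (fps_const \<mu> * fps_exp 1 - 1)) k"

lemma apostol_bernoulli_genfun:
  "(fps_const \<mu> * fps_exp 1 - 1) * Abs_fps (\<lambda>k. apostol_bernoulli k q \<mu> / fact k)
     = fps_X * fps_exp q"
proof -
  define g :: "complex fps" where "g = fps_const \<mu> * fps_exp 1 - 1"
  have nth: "fps_nth g 0 = \<mu> - 1" "fps_nth g 1 = \<mu>"
    by (simp_all add: g_def)
  have g0: "g \<noteq> 0"
    using nth by (metis fps_zero_nth diff_0 neg_equal_0_iff_equal zero_neq_one)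
  have "subdegree g \<le> 1"
  proof (cases "\<mu> = 0")
    case True
    hence "fps_nth g 0 \<noteq> 0" using nth by simp
    thus ?thesis by (metis subdegree_leI zero_le_one le_trans)
  next
    case False
    thus ?thesis using nth by (auto intro: subdegree_leI)
  qed
  moreover have "subdegree (fps_X * fps_exp q) = 1"
    by (rule subdegreeI) auto
  ultimately have "g dvd fps_X * fps_exp q"
    using g0 by (subst fps_dvd_iff) auto
  hence "g * (fps_X * fps_exp q / g) = fps_X * fps_exp q"
    by simp
  moreover have "Abs_fps (\<lambda>k. apostol_bernoulli k q \<mu> / fact k) = fps_X * fps_exp q / g"
    by (rule fps_ext) (simp add: apostol_bernoulli_def g_def)
  ultimately show ?thesis by (simp add: g_def)
qed

definition multi_indices :: "nat \<Rightarrow> nat \<Rightarrow> (nat \<Rightarrow> nat) set" where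
  "multi_indices b n = {i \<in> {..<b} \<rightarrow>\<^sub>E {0..n}. (\<Sum>j<b. i j) = n}"

definition multinomial :: "nat \<Rightarrow> nat \<Rightarrow> (nat \<Rightarrow> nat) \<Rightarrow> complex" where
  "multinomial n b i = fact n / (\<Prod>j<b. fact (i j))"

end

theory Submission
  imports Defs
begin

text \<open>
  Fix \<open>0 \<le> k < b\<close>. An element \<open>x * a + y * b\<close> of the semigroup that is congruent to \<open>a * k\<close> modulo
  \<open>b\<close> has \<open>x \<equiv> k\<close> modulo \<open>b\<close>, hence \<open>x \<ge> k\<close>: so the gaps in the residue class of \<open>a * k\<close> are exactly
  the numbers \<open>a * k - y * b \<ge> 0\<close> with \<open>y \<ge> 1\<close>, and there are \<open>\<lfloor>a * k / b\<rfloor>\<close> of them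
  (\<open>card_gaps_cong\<close>). Counting these gaps with the additive characters modulo \<open>b\<close> gives
  the discrete Fourier expansion
  \<open>\<lfloor>a * k / b\<rfloor> = 1 / b * (\<Sum>j<b. C(\<epsilon>^j) * \<epsilon>^(- a * j * k))\<close>
  of \<open>floor_fourier\<close>. Its \<open>n\<close>-th power, expanded by the multinomial theorem, is a combination
  of terms \<open>\<mu> ^ k\<close> with \<open>\<mu>\<close> a \<open>b\<close>-th root of unity; multiplying by \<open>k ^ m\<close> and summing over
  \<open>k\<close> turns each of them into a Mirimanoff polynomial. The passage to Apostol--Bernoulli
  polynomials (\<open>mirimanoff_eq_apostol_bernoulli\<close>) is the geometric sum
  \<open>(\<mu> * e^t - 1) * (\<Sum>k<b. \<mu>^k * e^(k*t)) = \<mu>^b * e^(b*t) - 1\<close>, in which \<open>\<mu> ^ b = 1\<close>.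
\<close>

section \<open>Gaps in a residue class\<close>

text \<open>Within the class of \<open>a * k\<close>, membership in the semigroup is just \<open>\<ge> a * k\<close>, because
  \<open>k\<close> is the least nonnegative coefficient of \<open>a\<close> that reaches this class. The gaps are then
  \<open>a * k - b, a * k - 2 * b, \<dots>\<close> as long as the terms stay nonnegative.\<close>

lemma card_gaps_cong:
  fixes a b k :: nat
  assumes "b > 0" "coprime a b" "k < b"
  shows "card {g \<in> semigroup_gaps a b. [g = a * k] (mod b)} = a * k div b"
proof -
  have in_iff: "g \<in> numerical_semigroup a b \<longleftrightarrow> a * k \<le> g" if g: "[g = a * k] (mod b)" for g
  proof
    assume "g \<in> numerical_semigroup a b"
    then obtain x y where xy: "g = x * a + y * b"
      by (auto simp: numerical_semigroup_def)
    have "[a * x = a * k] (mod b)"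
      using g by (simp add: xy cong_def mult.commute)
    hence "[x = k] (mod b)"
      using assms(2) by (simp add: cong_mult_lcancel_nat)
    hence "k \<le> x"
      using assms(3) by (metis cong_def mod_less mod_less_eq_dividend)
    thus "a * k \<le> g"
      by (simp add: xy mult.commute trans_le_add1)
  next
    assume le: "a * k \<le> g"
    hence "b dvd g - a * k"
      using g by (metis cong_altdef_nat)
    then obtain y where "g - a * k = b * y" by (elim dvdE)
    hence "g = k * a + y * b" using le by (simp add: algebra_simps)
    thus "g \<in> numerical_semigroup a b"
      by (auto simp: numerical_semigroup_def)
  qed
  have "bij_betw (\<lambda>y. a * k - y * b) {1..a * k div b}
          {g \<in> semigroup_gaps a b. [g = a * k] (mod b)}"
  proof (rule bij_betwI[where g = "\<lambda>g. (a * k - g) div b"])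
    show "(\<lambda>y. a * k - y * b) \<in> {1..a * k div b} \<rightarrow>
            {g \<in> semigroup_gaps a b. [g = a * k] (mod b)}"
    proof
      fix y assume y: "y \<in> {1..a * k div b}"
      have yb: "y * b \<le> a * k" "0 < y * b"
        using y assms(1) by (auto simp: less_eq_div_iff_mult_less_eq)
      have "[a * k - y * b = a * k] (mod b)"
        using yb(1) by (metis cong_def le_add_diff_inverse2 mod_mult_self1)
      moreover from this have "a * k - y * b \<in> semigroup_gaps a b"
        using yb in_iff[of "a * k - y * b"] by (simp add: semigroup_gaps_def; linarith)
      ultimately show "a * k - y * b \<in> {g \<in> semigroup_gaps a b. [g = a * k] (mod b)}"
        by simp
    qed
  next
    show "(\<lambda>g. (a * k - g) div b) \<in> {g \<in> semigroup_gaps a b. [g = a * k] (mod b)} \<rightarrow>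
            {1..a * k div b}"
    proof
      fix g assume "g \<in> {g \<in> semigroup_gaps a b. [g = a * k] (mod b)}"
      hence g: "g \<in> semigroup_gaps a b" "[g = a * k] (mod b)" by auto
      hence lt: "g < a * k"
        using in_iff by (force simp: semigroup_gaps_def)
      hence "b dvd a * k - g"
        using g(2) by (metis cong_altdef_nat cong_sym less_imp_le)
      hence "b \<le> a * k - g"
        using lt by (simp add: dvd_imp_le)
      thus "(a * k - g) div b \<in> {1..a * k div b}"
        using assms(1) div_le_mono[of "a * k - g" "a * k" b]
        by (simp add: div_greater_zero_iff Suc_le_eq)
    qed
  next
    fix y assume y: "y \<in> {1..a * k div b}"
    hence "y * b \<le> a * k"
      using assms(1) by (auto simp: less_eq_div_iff_mult_less_eq)
    thus "(a * k - (a * k - y * b)) div b = y"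
      using assms(1) by simp
  next
    fix g assume "g \<in> {g \<in> semigroup_gaps a b. [g = a * k] (mod b)}"
    hence g: "g \<in> semigroup_gaps a b" "[g = a * k] (mod b)" by auto
    hence lt: "g < a * k"
      using in_iff by (force simp: semigroup_gaps_def)
    hence "b dvd a * k - g"
      using g(2) by (metis cong_altdef_nat cong_sym less_imp_le)
    thus "a * k - (a * k - g) div b * b = g"
      using lt by simp
  qed
  from bij_betw_same_card[OF this] show ?thesis by simp
qed

section \<open>Roots of unity and the Fourier expansion of the floor\<close>

lemma eps_nonzero [simp]: "eps b \<noteq> 0"
  by (simp add: eps_def)

lemma eps_powi_eq_1_iff:
  assumes "b > 0"
  shows "eps b powi z = 1 \<longleftrightarrow> int b dvd z"
proof -
  define w where "w = real_of_int z / real b"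
  have "eps b powi z = exp (2 * of_real pi * \<i> * of_real w)"
    by (simp add: eps_def w_def exp_power_int mult_ac)
  also have "\<dots> = 1 \<longleftrightarrow> (\<exists>l::int. w = real_of_int l)"
    by (simp add: exp_eq_1 mult.commute)
  also have "\<dots> \<longleftrightarrow> (\<exists>l::int. real_of_int z = real_of_int (int b * l))"
    using assms by (auto simp: w_def field_simps)
  also have "\<dots> \<longleftrightarrow> int b dvd z"
    unfolding of_int_eq_iff dvd_def ..
  finally show ?thesis .
qed

lemma eps_powi_power_self: "b > 0 \<Longrightarrow> (eps b powi z) ^ b = 1"
  using eps_powi_eq_1_iff[of b "z * int b"] by (simp add: power_int_mult)

lemma sum_eps_powi:
  assumes "b > 0"
  shows "(\<Sum>j<b. eps b powi (int j * z)) = (if int b dvd z then of_nat b else 0)"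
proof -
  have "(\<Sum>j<b. eps b powi (int j * z)) = (\<Sum>j<b. (eps b powi z) ^ j)"
    by (simp add: mult.commute power_int_mult)
  also have "\<dots> = (if int b dvd z then of_nat b else 0)"
    using assms by (simp add: geometric_sum eps_powi_power_self flip: eps_powi_eq_1_iff)
  finally show ?thesis .
qed

text \<open>Expanding \<open>gap_poly\<close> and exchanging the sums leaves, for each gap \<open>g\<close>, the character sum
  that detects \<open>g \<equiv> a * k\<close> modulo \<open>b\<close>; so the right-hand side counts the gaps in that class.\<close>

lemma floor_fourier:
  fixes a b k :: nat
  assumes "a > 0" "b > 0" "coprime a b" "k < b"
  shows "of_int \<lfloor>real a * real k / real b\<rfloor> =
           1 / of_nat b * (\<Sum>j<b. gap_poly a b (eps b ^ j) * (eps b powi (- int a * int j)) ^ k)"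
proof -
  let ?G = "semigroup_gaps a b"
  have fin: "finite ?G"
    using assms finite_semigroup_gaps by blast
  have term_eq: "(eps b ^ j) ^ g * (eps b powi (- int a * int j)) ^ k
          = eps b powi (int j * (int g - int (a * k)))" for j g
  proof -
    have "(eps b ^ j) ^ g = eps b powi (int j * int g)"
      by (simp add: power_int_mult)
    moreover have "(eps b powi (- int a * int j)) ^ k = eps b powi (- int a * int j * int k)"
      by (simp only: power_int_mult power_int_of_nat)
    ultimately show ?thesis
      by (simp add: algebra_simps flip: power_int_add)
  qed
  have "(\<Sum>j<b. gap_poly a b (eps b ^ j) * (eps b powi (- int a * int j)) ^ k)
      = (\<Sum>g\<in>?G. \<Sum>j<b. eps b powi (int j * (int g - int (a * k))))"
    unfolding gap_poly_def sum_distrib_right term_eq by (rule sum.swap)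
  also have "\<dots> = (\<Sum>g\<in>?G. if [g = a * k] (mod b) then of_nat b else 0)"
    using assms by (simp only: sum_eps_powi cong_iff_dvd_diff flip: cong_int_iff)
  also have "\<dots> = of_nat b * of_nat (card {g \<in> ?G. [g = a * k] (mod b)})"
    using fin by (simp add: sum.If_cases Int_def)
  also have "\<dots> = of_nat b * of_nat (a * k div b)"
    using assms by (simp add: card_gaps_cong)
  finally have "1 / of_nat b * (\<Sum>j<b. gap_poly a b (eps b ^ j) * (eps b powi (- int a * int j)) ^ k)
      = (of_nat (a * k div b) :: complex)"
    using assms by simp
  moreover have "\<lfloor>real a * real k / real b\<rfloor> = int (a * k div b)"
    using floor_divide_of_nat_eq[of "a * k" b, where ?'a = real] by simp
  ultimately show ?thesis by simp
qed

section \<open>The multinomial theorem\<close>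

text \<open>An entry larger than \<open>n\<close> would already exceed the sum, so the range \<open>{0..n}\<close> in the
  definition is implied; dropping it makes reindexing by the last entry immediate.\<close>

lemma multi_indices_iff:
  "i \<in> multi_indices b n \<longleftrightarrow> i \<in> extensional {..<b} \<and> (\<Sum>j<b. i j) = n"
proof -
  have "i j \<le> (\<Sum>j<b. i j)" if "j < b" for j
    using that by (intro member_le_sum) auto
  thus ?thesis
    by (auto simp: multi_indices_def PiE_iff)
qed

lemma finite_multi_indices [simp]: "finite (multi_indices b n)"
  by (rule finite_subset[of _ "{..<b} \<rightarrow>\<^sub>E {0..n}"]) (auto simp: multi_indices_def intro!: finite_PiE)

text \<open>Dividing by \<open>fact n\<close> makes the binomial theorem a plain convolution, so that the induction
  splits off the exponent of the last variable without any multinomial coefficients.\<close>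

lemma exponential_multinomial:
  fixes x :: "nat \<Rightarrow> 'a :: field_char_0"
  shows "(\<Sum>j<b. x j) ^ n / fact n = (\<Sum>i\<in>multi_indices b n. \<Prod>j<b. x j ^ i j / fact (i j))"
proof (induction b arbitrary: n)
  case 0
  have "multi_indices 0 n = (if n = 0 then {\<lambda>_. undefined} else {})"
    by (auto simp: multi_indices_iff)
  thus ?case by simp
next
  case (Suc b)
  let ?w = "\<lambda>b i. \<Prod>j<b. x j ^ i j / fact (i j)"
  have "(\<Sum>j<Suc b. x j) ^ n / fact n
      = (\<Sum>k\<le>n. of_nat (n choose k) * x b ^ k * (\<Sum>j<b. x j) ^ (n - k)) / fact n"
    by (simp add: add.commute binomial_ring)
  also have "\<dots> = (\<Sum>k\<le>n. x b ^ k / fact k * ((\<Sum>j<b. x j) ^ (n - k) / fact (n - k)))"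
    unfolding sum_divide_distrib
    by (intro sum.cong refl) (simp add: binomial_fact)
  also have "\<dots> = (\<Sum>k\<le>n. \<Sum>i\<in>multi_indices b (n - k). x b ^ k / fact k * ?w b i)"
    by (simp add: Suc.IH sum_distrib_left)
  also have "\<dots> = (\<Sum>(k, i)\<in>(SIGMA k:{..n}. multi_indices b (n - k)). x b ^ k / fact k * ?w b i)"
    by (rule sum.Sigma) auto
  also have "\<dots> = (\<Sum>i\<in>multi_indices (Suc b) n. ?w (Suc b) i)"
  proof (rule sum.reindex_bij_witness
      [where i = "\<lambda>i. (i b, i(b := undefined))" and j = "\<lambda>(k, i). i(b := k)"], goal_cases)
    case (1 p)
    thus ?case
      by (auto simp: multi_indices_iff extensional_def fun_eq_iff)
  next
    case (2 p)
    thus ?case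
      by (auto simp: multi_indices_iff extensional_def)
  next
    case (3 i)
    thus ?case by (auto simp: fun_eq_iff)
  next
    case (4 i)
    thus ?case
      by (auto simp: multi_indices_iff extensional_def)
  next
    case (5 p)
    thus ?case by (auto simp: mult.commute)
  qed
  finally show ?case .
qed

lemma multinomial_theorem:
  "(\<Sum>j<b. x j) ^ n = (\<Sum>i\<in>multi_indices b n. multinomial n b i * (\<Prod>j<b. x j ^ i j))"
proof -
  have "(\<Sum>j<b. x j) ^ n = fact n * ((\<Sum>j<b. x j) ^ n / fact n)"
    by simp
  also have "\<dots> = (\<Sum>i\<in>multi_indices b n. multinomial n b i * (\<Prod>j<b. x j ^ i j))"
    unfolding exponential_multinomial
    by (simp add: sum_distrib_left multinomial_def prod_dividef)
  finally show ?thesis .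
qed

section \<open>Mirimanoff and Apostol--Bernoulli polynomials\<close>

text \<open>Let \<open>D = \<mu> * e^t - 1\<close> and \<open>S = (\<Sum>k<b. \<mu>^k * e^(k*t))\<close>. The geometric sum gives
  \<open>D * S = e^(b*t) - 1\<close>, so \<open>D * (t * S)\<close> is \<open>D\<close> times the difference of the two generating
  functions. For \<open>\<mu> = 1\<close> the series \<open>D\<close> is not invertible, but it is always nonzero and may be
  cancelled in the integral domain of power series. The claim is the coefficient of \<open>t^(m+1)\<close>.\<close>

lemma mirimanoff_eq_apostol_bernoulli:
  assumes "b > 0" "\<mu> ^ b = 1"
  shows "mirimanoff (b - 1) \<mu> m =
           (apostol_bernoulli (m + 1) (of_nat b) \<mu> - apostol_bernoulli (m + 1) 0 \<mu>) / of_nat (m + 1)"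
proof -
  define D :: "complex fps" where "D = fps_const \<mu> * fps_exp 1 - 1"
  define B :: "complex \<Rightarrow> complex fps"
    where "B q = Abs_fps (\<lambda>k. apostol_bernoulli k q \<mu> / fact k)" for q
  define S :: "complex fps" where "S = (\<Sum>k<b. fps_const (\<mu> ^ k) * fps_exp (of_nat k))"
  have genfun: "D * B q = fps_X * fps_exp q" for q
    unfolding D_def B_def by (rule apostol_bernoulli_genfun)
  have pow: "(fps_const \<mu> * fps_exp 1) ^ k = fps_const (\<mu> ^ k) * fps_exp (of_nat k)" for k
    by (simp add: power_mult_distrib fps_const_power fps_exp_power_mult)
  have "D * S = (fps_const \<mu> * fps_exp 1) ^ b - 1"
    unfolding D_def S_def pow[symmetric] by (rule power_diff_1_eq[symmetric])
  also have "\<dots> = fps_exp (of_nat b) - 1"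
    by (simp add: pow assms)
  finally have "D * (fps_X * S) = D * (B (of_nat b) - B 0)"
    by (simp add: right_diff_distrib genfun mult.left_commute[of D])
  moreover have "D \<noteq> 0"
  proof
    assume "D = 0"
    hence "fps_nth D 0 = 0" "fps_nth D 1 = 0" by auto
    thus False by (simp add: D_def)
  qed
  ultimately have "fps_nth (fps_X * S) (m + 1) = fps_nth (B (of_nat b) - B 0) (m + 1)"
    by simp
  hence "(\<Sum>k<b. \<mu> ^ k * of_nat k ^ m) / fact m
      = (apostol_bernoulli (m + 1) (of_nat b) \<mu> - apostol_bernoulli (m + 1) 0 \<mu>) / fact (m + 1)"
    by (simp add: S_def B_def fps_sum_nth diff_divide_distrib sum_divide_distrib)
  also have "\<dots> = (apostol_bernoulli (m + 1) (of_nat b) \<mu> - apostol_bernoulli (m + 1) 0 \<mu>)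
      / of_nat (m + 1) / fact m"
    by (simp add: fact_Suc)
  finally have "(\<Sum>k<b. \<mu> ^ k * of_nat k ^ m)
      = (apostol_bernoulli (m + 1) (of_nat b) \<mu> - apostol_bernoulli (m + 1) 0 \<mu>) / of_nat (m + 1)"
    by (simp only: divide_cancel_right fact_nonzero) simp
  moreover have "{0..b - 1} = {..<b}" using assms by auto
  ultimately show ?thesis
    by (simp add: mirimanoff_def mult.commute)
qed

section \<open>Voronoi sums\<close>

text \<open>Since \<open>m > 0\<close>, the Voronoi sum may be started at \<open>k = 0\<close>, which is where the
  Mirimanoff polynomial starts.\<close>

lemma voronoi_sum_fourier:
  assumes "a > 0" "b > 0" "coprime a b" "m > 0"
  shows "of_int (voronoi_sum m n a b) = 1 / of_nat b ^ n *
           (\<Sum>k=0..b - 1. of_nat k ^ m *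
             (\<Sum>j<b. gap_poly a b (eps b ^ j) * (eps b powi (- int a * int j)) ^ k) ^ n)"
proof -
  let ?F = "\<lambda>k. \<Sum>j<b. gap_poly a b (eps b ^ j) * (eps b powi (- int a * int j)) ^ k"
  have "voronoi_sum m n a b = (\<Sum>k=0..b - 1. int k ^ m * \<lfloor>real a * real k / real b\<rfloor> ^ n)"
    unfolding voronoi_sum_def
    by (rule sum.mono_neutral_left) (use assms in \<open>auto simp: Suc_le_eq\<close>)
  hence "of_int (voronoi_sum m n a b)
      = (\<Sum>k=0..b - 1. of_nat k ^ m * of_int \<lfloor>real a * real k / real b\<rfloor> ^ n :: complex)"
    by simp
  also have "\<dots> = (\<Sum>k=0..b - 1. of_nat k ^ m * (1 / of_nat b * ?F k) ^ n)"
    using assms by (intro sum.cong refl) (subst floor_fourier, auto)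
  also have "\<dots> = 1 / of_nat b ^ n * (\<Sum>k=0..b - 1. of_nat k ^ m * ?F k ^ n)"
    by (simp only: power_mult_distrib power_one_over sum_distrib_left[of _ _ "{0..b - 1}"] mult.left_commute)
  finally show ?thesis .
qed

lemma power_int_sum:
  fixes x :: "'a :: field"
  assumes "x \<noteq> 0"
  shows "x powi (\<Sum>j\<in>A. f j) = (\<Prod>j\<in>A. x powi f j)"
  by (induction A rule: infinite_finite_induct) (simp_all add: assms power_int_add)

text \<open>The \<open>k\<close>-dependence of a monomial in the \<open>n\<close>-th power of the Fourier expansion collapses to
  \<open>\<mu> ^ k\<close> with the single root of unity \<open>\<mu> = \<epsilon> ^ (- a * (\<Sum>j<b. j * i j))\<close>, so the sum over
  \<open>k\<close> can be carried out monomial by monomial.\<close>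

lemma voronoi_sum_multinomial:
  assumes "a > 0" "b > 0" "coprime a b" "m > 0"
  shows "of_int (voronoi_sum m n a b) = 1 / of_nat b ^ n *
           (\<Sum>i\<in>multi_indices b n.
              multinomial n b i * (\<Prod>j<b. gap_poly a b (eps b ^ j) ^ i j) *
              mirimanoff (b - 1) (eps b powi (- int a * int (\<Sum>j<b. j * i j))) m)"
proof -
  let ?\<mu> = "\<lambda>i. eps b powi (- int a * int (\<Sum>j<b. j * i j))"
  let ?C = "\<lambda>i. multinomial n b i * (\<Prod>j<b. gap_poly a b (eps b ^ j) ^ i j)"
  have prod_eps: "(\<Prod>j<b. ((eps b powi (- int a * int j)) ^ k) ^ i j) = ?\<mu> i ^ k" for i k
  proof -
    have pow: "((eps b powi c) ^ k) ^ l = (eps b powi (c * int l)) ^ k" for c l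
      by (simp add: power_int_mult mult.commute flip: power_mult)
    have "(\<Prod>j<b. ((eps b powi (- int a * int j)) ^ k) ^ i j)
        = (\<Prod>j<b. (eps b powi (- int a * int j * int (i j))) ^ k)"
      by (simp only: pow)
    also have "\<dots> = (eps b powi (\<Sum>j<b. - int a * int j * int (i j))) ^ k"
      by (simp only: power_int_sum[OF eps_nonzero] prod_power_distrib)
    also have "(\<Sum>j<b. - int a * int j * int (i j)) = - int a * int (\<Sum>j<b. j * i j)"
      by (simp add: sum_distrib_left sum_negf mult.assoc)
    finally show ?thesis .
  qed
  have "(\<Sum>k=0..b - 1. of_nat k ^ m *
           (\<Sum>j<b. gap_poly a b (eps b ^ j) * (eps b powi (- int a * int j)) ^ k) ^ n)
      = (\<Sum>k=0..b - 1. \<Sum>i\<in>multi_indices b n. ?C i * (of_nat k ^ m * ?\<mu> i ^ k))"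
    unfolding multinomial_theorem power_mult_distrib prod.distrib prod_eps sum_distrib_left
    by (simp only: mult_ac)
  also have "\<dots> = (\<Sum>i\<in>multi_indices b n. ?C i * mirimanoff (b - 1) (?\<mu> i) m)"
    unfolding mirimanoff_def sum_distrib_left by (rule sum.swap)
  finally show ?thesis
    by (simp only: voronoi_sum_fourier[OF assms])
qed

text \<open>For \<open>n = 1\<close> the Fourier expansion is already linear in the values of the gap polynomial.\<close>

lemma voronoi_sum_linear:
  assumes "a > 0" "b > 0" "coprime a b" "m > 0"
  shows "of_int (voronoi_sum m 1 a b) = 1 / of_nat b *
           (\<Sum>j<b. gap_poly a b (eps b ^ j) * mirimanoff (b - 1) (eps b powi (- int a * int j)) m)"
proof -
  let ?\<mu> = "\<lambda>j. eps b powi (- int a * int j)"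
  have "(\<Sum>k=0..b - 1. of_nat k ^ m * (\<Sum>j<b. gap_poly a b (eps b ^ j) * ?\<mu> j ^ k))
      = (\<Sum>k=0..b - 1. \<Sum>j<b. gap_poly a b (eps b ^ j) * (of_nat k ^ m * ?\<mu> j ^ k))"
    by (simp only: sum_distrib_left mult_ac)
  also have "\<dots> = (\<Sum>j<b. gap_poly a b (eps b ^ j) * mirimanoff (b - 1) (?\<mu> j) m)"
    unfolding mirimanoff_def sum_distrib_left by (rule sum.swap)
  finally show ?thesis
    by (simp only: voronoi_sum_fourier[OF assms] power_one_right)
qed

theorem mainTheorem2:
  fixes a b m n :: nat
  assumes "a > 0" and "b > 0" and "coprime a b" and "m > 0"
  shows
    "of_int (voronoi_sum m n a b) =
       1 / of_nat b ^ n *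
       (\<Sum>i\<in>multi_indices b n.
          multinomial n b i * (\<Prod>j<b. gap_poly a b (eps b ^ j) ^ i j) *
          mirimanoff (b - 1) (eps b powi (- int a * int (\<Sum>j<b. j * i j))) m)
     \<and>
     1 / of_nat b ^ n *
       (\<Sum>i\<in>multi_indices b n.
          multinomial n b i * (\<Prod>j<b. gap_poly a b (eps b ^ j) ^ i j) *
          mirimanoff (b - 1) (eps b powi (- int a * int (\<Sum>j<b. j * i j))) m)
     = 1 / of_nat b ^ n *
       (\<Sum>i\<in>multi_indices b n.
          multinomial n b i * (\<Prod>j<b. gap_poly a b (eps b ^ j) ^ i j) *
          ((apostol_bernoulli (m + 1) (of_nat b) (eps b powi (- int a * int (\<Sum>j<b. j * i j)))
            - apostol_bernoulli (m + 1) 0 (eps b powi (- int a * int (\<Sum>j<b. j * i j))))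
           / of_nat (m + 1)))
     \<and>
     of_int (voronoi_sum m 1 a b) =
       1 / of_nat b *
       (\<Sum>j<b. gap_poly a b (eps b ^ j) * mirimanoff (b - 1) (eps b powi (- int a * int j)) m)
     \<and>
     1 / of_nat b *
       (\<Sum>j<b. gap_poly a b (eps b ^ j) * mirimanoff (b - 1) (eps b powi (- int a * int j)) m)
     = 1 / of_nat b *
       (\<Sum>j<b. gap_poly a b (eps b ^ j) *
          ((apostol_bernoulli (m + 1) (of_nat b) (eps b powi (- int a * int j))
            - apostol_bernoulli (m + 1) 0 (eps b powi (- int a * int j)))
           / of_nat (m + 1)))"
proof -
  have bernoulli: "mirimanoff (b - 1) (eps b powi z) m =
      (apostol_bernoulli (m + 1) (of_nat b) (eps b powi z) - apostol_bernoulli (m + 1) 0 (eps b powi z))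
        / of_nat (m + 1)" for z
    using assms by (intro mirimanoff_eq_apostol_bernoulli eps_powi_power_self)
  show ?thesis
    by (intro conjI voronoi_sum_multinomial voronoi_sum_linear assms) (simp_all only: bernoulli)
qed

end
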